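(* Let $\Bbbk$ be an algebraically closed field of characteristic $p>0$. Suppose $G$ is a finite group and $P$ a Sylow $p$-subgroup of $G$. If $V=V_{\mathrm{reg},G}^{\,n}$ is a free $G$-module over $\Bbbk$, where $V_{\mathrm{reg},G}=\Bbbk G$ is the regular representation, then $\epsilon(G,v)=|P|$ for any $v\in V^G\setminus\{0\}$.
   Context: $\Bbbk[V]\cong S(V^* )$ is the ring of polynomial functions on $V$, with $G$-action $(g\cdot f)(v)=f(g^{-1}v)$; $\Bbbk[V]^G_d$ is the set of homogeneous invariants of degree $d$ together with $0$. For $v\in V$, $\epsilon(G,v)=\inf\{d\in\mathbb{N}_{>0} : \text{there exists } f\in\Bbbk[V]^G_d\text{ with } f(v)\neq 0\}$, where the infimum of the empty set is $\infty$. *)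

theory Defs
  imports
    "HOL-Computational_Algebra.Polynomial"
    "HOL-Computational_Algebra.Primes"
    "HOL-Algebra.Coset"
    "HOL-Library.Function_Algebras"
    "HOL-Library.Extended_Nat"
    "HOL-Library.FuncSet"
begin

definition sylow_subgroup :: "nat \<Rightarrow> ('g, 'b) monoid_scheme \<Rightarrow> 'g set \<Rightarrow> bool" where
  "sylow_subgroup p G P \<longleftrightarrow>
     subgroup P G \<and> card P = p ^ multiplicity p (Coset.order G)"

text \<open>
  A \<open>G\<close>-module is given by its scalar multiplication \<open>scale\<close>, its carrier \<open>V\<close> (a linear subspace
  of an ambient additive group) and its action \<open>act\<close>. Functions on \<open>V\<close> are elements of
  \<open>extensional V\<close>, so that equality of functions means equality on \<open>V\<close>.
\<close>

definition linear_form_on ::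
  "('k::field \<Rightarrow> 'v::ab_group_add \<Rightarrow> 'v) \<Rightarrow> 'v set \<Rightarrow> ('v \<Rightarrow> 'k) \<Rightarrow> bool" where
  "linear_form_on scale V l \<longleftrightarrow>
     (\<forall>u\<in>V. \<forall>w\<in>V. l (u + w) = l u + l w) \<and>
     (\<forall>c. \<forall>u\<in>V. l (scale c u) = c * l u)"

text \<open>
  The degree \<open>d\<close> part of \<open>k[V] = S(V\<^sup>*)\<close>: linear combinations of \<open>d\<close>-fold products of
  linear forms. The empty combination (\<open>m = 0\<close>) gives the zero function. Over an infinite field
  and for finite-dimensional \<open>V\<close>, polynomials are faithfully represented by the functions they
  induce.
\<close>

definition hom_polyfuns ::
  "('k::field \<Rightarrow> 'v::ab_group_add \<Rightarrow> 'v) \<Rightarrow> 'v set \<Rightarrow> nat \<Rightarrow> ('v \<Rightarrow> 'k) set" where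
  "hom_polyfuns scale V d =
     {f \<in> extensional V.
        \<exists>(m::nat) (c :: nat \<Rightarrow> 'k) (l :: nat \<Rightarrow> nat \<Rightarrow> 'v \<Rightarrow> 'k).
          (\<forall>j<m. \<forall>i<d. linear_form_on scale V (l j i)) \<and>
          (\<forall>v\<in>V. f v = (\<Sum>j<m. c j * (\<Prod>i<d. l j i v)))}"

definition fun_act ::
  "('g, 'b) monoid_scheme \<Rightarrow> 'v set \<Rightarrow> ('g \<Rightarrow> 'v \<Rightarrow> 'v) \<Rightarrow> 'g \<Rightarrow> ('v \<Rightarrow> 'k) \<Rightarrow> 'v \<Rightarrow> 'k" where
  "fun_act G V act g f = (\<lambda>v\<in>V. f (act (inv\<^bsub>G\<^esub> g) v))"

definition hom_invariants ::
  "('g, 'b) monoid_scheme \<Rightarrow> ('k::field \<Rightarrow> 'v::ab_group_add \<Rightarrow> 'v) \<Rightarrow> 'v set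
     \<Rightarrow> ('g \<Rightarrow> 'v \<Rightarrow> 'v) \<Rightarrow> nat \<Rightarrow> ('v \<Rightarrow> 'k) set" where
  "hom_invariants G scale V act d =
     {f \<in> hom_polyfuns scale V d. \<forall>g\<in>carrier G. fun_act G V act g f = f}"

definition fixed_vectors ::
  "('g, 'b) monoid_scheme \<Rightarrow> 'v set \<Rightarrow> ('g \<Rightarrow> 'v \<Rightarrow> 'v) \<Rightarrow> 'v set" where
  "fixed_vectors G V act = {v \<in> V. \<forall>g\<in>carrier G. act g v = v}"

text \<open>In \<^typ>\<open>enat\<close> the infimum of the empty set is \<open>\<infinity>\<close>.\<close>

definition epsilon ::
  "('g, 'b) monoid_scheme \<Rightarrow> ('k::field \<Rightarrow> 'v::ab_group_add \<Rightarrow> 'v) \<Rightarrow> 'v set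
     \<Rightarrow> ('g \<Rightarrow> 'v \<Rightarrow> 'v) \<Rightarrow> 'v \<Rightarrow> enat" where
  "epsilon G scale V act v =
     Inf {enat d | d. d > 0 \<and> (\<exists>f \<in> hom_invariants G scale V act d. f v \<noteq> 0)}"

text \<open>
  The regular representation \<open>kG\<close> of a finite group: \<open>a\<close> stands for \<open>\<Sum>x. a x \<cdot> x\<close>, and
  \<open>g \<cdot> \<Sum>x. a x \<cdot> x = \<Sum>x. a x \<cdot> (g x) = \<Sum>x. a (g\<^sup>-\<^sup>1 x) \<cdot> x\<close>.
\<close>

definition reg_carrier :: "('g, 'b) monoid_scheme \<Rightarrow> ('g \<Rightarrow> 'k::field) set" where
  "reg_carrier G = {a. \<forall>x. x \<notin> carrier G \<longrightarrow> a x = 0}"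

definition reg_act :: "('g, 'b) monoid_scheme \<Rightarrow> 'g \<Rightarrow> ('g \<Rightarrow> 'k::field) \<Rightarrow> 'g \<Rightarrow> 'k" where
  "reg_act G g a = (\<lambda>x. if x \<in> carrier G then a (inv\<^bsub>G\<^esub> g \<otimes>\<^bsub>G\<^esub> x) else 0)"

text \<open>The free module \<open>(kG)\<^sup>n\<close>, with components indexed by \<open>{..<n}\<close> and zero beyond.\<close>

definition free_carrier ::
  "('g, 'b) monoid_scheme \<Rightarrow> nat \<Rightarrow> (nat \<Rightarrow> 'g \<Rightarrow> 'k::field) set" where
  "free_carrier G n = {v. (\<forall>i<n. v i \<in> reg_carrier G) \<and> (\<forall>i\<ge>n. v i = 0)}"

definition free_scale :: "'k::field \<Rightarrow> (nat \<Rightarrow> 'g \<Rightarrow> 'k) \<Rightarrow> nat \<Rightarrow> 'g \<Rightarrow> 'k" where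
  "free_scale c v = (\<lambda>i x. c * v i x)"

definition free_act ::
  "('g, 'b) monoid_scheme \<Rightarrow> 'g \<Rightarrow> (nat \<Rightarrow> 'g \<Rightarrow> 'k::field) \<Rightarrow> nat \<Rightarrow> 'g \<Rightarrow> 'k" where
  "free_act G g v = (\<lambda>i. reg_act G g (v i))"

lemma vector_space_free_scale:
  "vector_space (free_scale :: 'k::field \<Rightarrow> (nat \<Rightarrow> 'g \<Rightarrow> 'k) \<Rightarrow> _)"
  by unfold_locales (auto simp: free_scale_def fun_eq_iff algebra_simps)

lemma subspace_free_carrier:
  "module.subspace free_scale (free_carrier G n :: (nat \<Rightarrow> 'g \<Rightarrow> 'k::field) set)"
proof -
  interpret vector_space "free_scale :: 'k \<Rightarrow> (nat \<Rightarrow> 'g \<Rightarrow> 'k) \<Rightarrow> _"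
    by (rule vector_space_free_scale)
  show ?thesis
    unfolding subspace_def
    by (auto simp: free_scale_def free_carrier_def reg_carrier_def fun_eq_iff)
qed

lemma free_act_closed:
  "v \<in> free_carrier G n \<Longrightarrow> free_act G g v \<in> free_carrier G n"
  by (auto simp: free_carrier_def free_act_def reg_carrier_def reg_act_def fun_eq_iff)

lemma free_act_linear:
  "free_act G g (u + w) = free_act G g u + free_act G g w"
  "free_act G g (free_scale c u) = free_scale c (free_act G g u)"
  by (auto simp: free_scale_def free_act_def reg_act_def fun_eq_iff)

lemma free_act_one:
  assumes "group G" "v \<in> free_carrier G n"
  shows "free_act G \<one>\<^bsub>G\<^esub> v = v"
proof (intro ext)
  interpret group G by fact
  fix i x
  show "free_act G \<one>\<^bsub>G\<^esub> v i x = v i x"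
    using assms(2)
    by (cases "i < n")
       (auto simp: free_carrier_def free_act_def reg_carrier_def reg_act_def)
qed

lemma free_act_mult:
  assumes "group G" "g \<in> carrier G" "h \<in> carrier G"
  shows "free_act G (g \<otimes>\<^bsub>G\<^esub> h) v = free_act G g (free_act G h v)"
proof -
  interpret group G by fact
  show ?thesis
    using assms(2,3)
    by (auto simp: free_act_def reg_act_def fun_eq_iff inv_mult_group m_assoc)
qed

end

theory Submission
  imports Defs "HOL-Algebra.Group_Action" "HOL-Algebra.Left_Coset"
begin

text \<open>
  A fixed vector \<open>v\<close> is constant on \<open>G\<close> in each component, so the invariant
  \<open>\<Sum>\<^bsub>C \<in> G/P\<^esub> \<Prod>\<^bsub>x \<in> C\<^esub> w\<^sub>i(x)\<close> of degree \<open>|P|\<close> takes the value \<open>[G : P] v\<^sub>i(1)\<^bsup>|P|\<^esup>\<close> at \<open>v\<close>,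
  which is nonzero for some \<open>i\<close> because \<open>p\<close> does not divide the index.
  Conversely, \<open>P\<close> permutes the monomials of degree \<open>d\<close> in the coordinate functions, and both the
  coefficients of an invariant and the values of monomials at \<open>v\<close> are constant on orbits.
  Since \<open>P\<close> acts freely on \<open>G\<close>, a monomial fixed by \<open>P\<close> has degree divisible by \<open>|P|\<close>. If
  \<open>|P|\<close> does not divide \<open>d\<close>, all orbits therefore have size divisible by \<open>p\<close>, and every
  invariant of degree \<open>d\<close> vanishes at \<open>v\<close>.
\<close>

lemma infinite_UNIV_alg_closed_field: "infinite (UNIV :: 'k::alg_closed_field set)"
proof
  assume fin: "finite (UNIV :: 'k set)"
  define q :: "'k poly" where "q = (\<Prod>a\<in>UNIV. [:-a, 1:])"
  have "degree q = card (UNIV :: 'k set)"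
    unfolding q_def by (subst degree_prod_eq_sum_degree) auto
  then have "degree (q + 1) > 0"
    using fin by (subst degree_add_eq_left) (auto simp: card_gt_0_iff)
  then obtain x where "poly (q + 1) x = 0"
    using alg_closed_imp_poly_has_root by blast
  moreover have "poly q x = 0"
    unfolding q_def poly_prod using fin by (auto simp: prod_zero_iff)
  ultimately show False by simp
qed

text \<open>The fourth assumption says that the exponents in \<open>E\<close> are determined by their values on \<open>I\<close>;
  unlike vanishing outside \<open>I\<close>, it passes from \<open>insert y I\<close> to \<open>I\<close> on the subset of \<open>E\<close>
  with a fixed exponent of \<open>y\<close>.\<close>

lemma monomials_independent:
  fixes c :: "('i \<Rightarrow> nat) \<Rightarrow> 'k::idom"
  assumes "infinite (UNIV :: 'k set)" "finite I" "finite E"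
    and "\<And>e e'. e \<in> E \<Longrightarrow> e' \<in> E \<Longrightarrow> \<forall>x\<in>I. e x = e' x \<Longrightarrow> e = e'"
    and "\<And>a. (\<Sum>e\<in>E. c e * (\<Prod>x\<in>I. a x ^ e x)) = 0"
    and "e \<in> E"
  shows "c e = 0"
  using assms(2-)
proof (induction I arbitrary: E e rule: finite_induct)
  case empty
  then have "E = {e}" by auto
  with empty show ?case by simp
next
  case (insert y I)
  define E' where "E' = {e' \<in> E. e' y = e y}"
  show ?case
  proof (rule insert.IH[of E'])
    show "finite E'" "e \<in> E'" using insert.prems by (auto simp: E'_def)
    show "e1 = e2" if "e1 \<in> E'" "e2 \<in> E'" "\<forall>x\<in>I. e1 x = e2 x" for e1 e2
      using insert.prems(2)[of e1 e2] that by (auto simp: E'_def)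
    fix a
    define q where "q = (\<Sum>e\<in>E. monom (c e * (\<Prod>x\<in>I. a x ^ e x)) (e y))"
    have "poly q t = 0" for t
    proof -
      have "poly q t = (\<Sum>e\<in>E. c e * (\<Prod>x\<in>insert y I. (a(y := t)) x ^ e x))"
        unfolding q_def poly_sum poly_monom
      proof (rule sum.cong[OF refl])
        fix e
        have "(\<Prod>x\<in>I. (a(y := t)) x ^ e x) = (\<Prod>x\<in>I. a x ^ e x)"
          using insert.hyps by (intro prod.cong) auto
        then show "c e * (\<Prod>x\<in>I. a x ^ e x) * t ^ e y
          = c e * (\<Prod>x\<in>insert y I. (a(y := t)) x ^ e x)"
          using insert.hyps by (simp add: mult_ac)
      qed
      then show ?thesis using insert.prems(3) by simp
    qed
    then have "q = 0"
      using poly_roots_finite[of q] assms(1) by fastforce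
    then have "coeff q (e y) = 0" by simp
    also have "coeff q (e y) = (\<Sum>e\<in>E'. c e * (\<Prod>x\<in>I. a x ^ e x))"
      unfolding q_def coeff_sum coeff_monom E'_def using insert.prems(1)
      by (intro sum.mono_neutral_cong_right) auto
    finally show "(\<Sum>e\<in>E'. c e * (\<Prod>x\<in>I. a x ^ e x)) = 0" .
  qed
qed

definition exponents :: "'i set \<Rightarrow> nat \<Rightarrow> ('i \<Rightarrow> nat) set" where
  "exponents I d = {e. (\<forall>q. q \<notin> I \<longrightarrow> e q = 0) \<and> sum e I = d}"

lemma finite_exponents:
  assumes "finite I"
  shows "finite (exponents I d)"
proof (rule finite_subset)
  show "exponents I d \<subseteq> {e. \<forall>q. (q \<in> I \<longrightarrow> e q \<in> {..d}) \<and> (q \<notin> I \<longrightarrow> e q = 0)}"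
    using assms by (auto simp: exponents_def intro: member_le_sum)
  show "finite {e. \<forall>q. (q \<in> I \<longrightarrow> e q \<in> {..d}) \<and> (q \<notin> I \<longrightarrow> e q = 0)}"
    using assms by (intro finite_set_of_finite_funs) auto
qed

lemma prod_linear_expand:
  fixes b :: "nat \<Rightarrow> 'i \<Rightarrow> 'k::comm_ring_1"
  assumes "finite I"
  shows "\<exists>c. \<forall>a. (\<Prod>i<d. \<Sum>q\<in>I. b i q * a q)
    = (\<Sum>e\<in>exponents I d. c e * (\<Prod>q\<in>I. a q ^ e q))"
proof -
  let ?W = "PiE {..<d} (\<lambda>_. I)"
  define content :: "(nat \<Rightarrow> 'i) \<Rightarrow> 'i \<Rightarrow> nat"
    where "content s = (\<lambda>q. card {i \<in> {..<d}. s i = q})" for s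
  define c where "c e = (\<Sum>s | s \<in> ?W \<and> content s = e. \<Prod>i<d. b i (s i))" for e
  have W: "finite ?W" using assms by (intro finite_PiE) auto
  have content: "content s \<in> exponents I d" if "s \<in> ?W" for s
  proof -
    have "content s q = 0" if "q \<notin> I" for q
      using \<open>s \<in> ?W\<close> that by (auto simp: content_def PiE_def)
    moreover have "sum (content s) I = d"
    proof -
      have "(\<Sum>q\<in>I. \<Sum>i | i \<in> {..<d} \<and> s i = q. 1) = (\<Sum>i<d. 1::nat)"
        using that assms by (intro sum.group) auto
      then show ?thesis by (simp add: content_def)
    qed
    ultimately show ?thesis by (simp add: exponents_def)
  qed
  have monom: "(\<Prod>i<d. a (s i)) = (\<Prod>q\<in>I. a q ^ content s q)" if "s \<in> ?W" for s and a :: "'i \<Rightarrow> 'k"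
  proof -
    have "(\<Prod>i<d. a (s i)) = (\<Prod>q\<in>I. \<Prod>i | i \<in> {..<d} \<and> s i = q. a (s i))"
      using that assms by (intro prod.group[symmetric]) auto
    also have "\<dots> = (\<Prod>q\<in>I. a q ^ content s q)"
      by (intro prod.cong) (auto simp: content_def)
    finally show ?thesis .
  qed
  have "(\<Prod>i<d. \<Sum>q\<in>I. b i q * a q)
    = (\<Sum>e\<in>exponents I d. c e * (\<Prod>q\<in>I. a q ^ e q))" for a
  proof -
    have "(\<Prod>i<d. \<Sum>q\<in>I. b i q * a q) = (\<Sum>s\<in>?W. \<Prod>i<d. b i (s i) * a (s i))"
      using assms by (intro prod_sum_PiE) auto
    also have "\<dots> = (\<Sum>s\<in>?W. (\<Prod>i<d. b i (s i)) * (\<Prod>q\<in>I. a q ^ content s q))"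
      by (intro sum.cong) (auto simp: prod.distrib monom)
    also have "\<dots> = (\<Sum>e\<in>exponents I d. \<Sum>s | s \<in> ?W \<and> content s = e.
        (\<Prod>i<d. b i (s i)) * (\<Prod>q\<in>I. a q ^ content s q))"
      using W finite_exponents[OF assms] content by (intro sum.group[symmetric]) blast+
    also have "\<dots> = (\<Sum>e\<in>exponents I d. c e * (\<Prod>q\<in>I. a q ^ e q))"
      unfolding c_def sum_distrib_right by (intro sum.cong) auto
    finally show ?thesis .
  qed
  then show ?thesis by blast
qed

lemma linear_form_on_sum:
  assumes V: "module.subspace scale V" "vector_space scale"
    and l: "linear_form_on scale V l"
    and "finite A" "\<And>a. a \<in> A \<Longrightarrow> u a \<in> V"
  shows "l (\<Sum>a\<in>A. scale (c a) (u a)) = (\<Sum>a\<in>A. c a * l (u a))"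
proof -
  interpret vector_space scale by fact
  have zero: "l 0 = 0"
    using l subspace_0[OF V(1)] unfolding linear_form_on_def
    by (metis mult_zero_left scale_zero_left)
  show ?thesis
    using assms(4,5)
  proof (induction A rule: finite_induct)
    case (insert x A)
    have "(\<Sum>a\<in>A. scale (c a) (u a)) \<in> V" "scale (c x) (u x) \<in> V"
      using insert.prems V(1) by (auto intro!: subspace_sum subspace_scale)
    then show ?case
      using insert l by (simp add: linear_form_on_def)
  qed (simp add: zero)
qed

abbreviation coords :: "('g, 'b) monoid_scheme \<Rightarrow> nat \<Rightarrow> (nat \<times> 'g) set" where
  "coords G n \<equiv> {..<n} \<times> carrier G"

lemma linear_form_on_free_carrier_expand:
  fixes l :: "(nat \<Rightarrow> 'g \<Rightarrow> 'k::field) \<Rightarrow> 'k"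
  assumes "finite (carrier G)" "linear_form_on free_scale (free_carrier G n) l"
  shows "\<exists>b. \<forall>w\<in>free_carrier G n. l w = (\<Sum>q\<in>coords G n. b q * case_prod w q)"
proof -
  define u :: "nat \<times> 'g \<Rightarrow> nat \<Rightarrow> 'g \<Rightarrow> 'k" where "u q = (\<lambda>i x. if q = (i, x) then 1 else 0)" for q
  have u: "u q \<in> free_carrier G n" if "q \<in> coords G n" for q
    using that by (auto simp: u_def free_carrier_def reg_carrier_def fun_eq_iff)
  have sum_apply: "(\<Sum>q\<in>A. h q) i x = (\<Sum>q\<in>A. h q i x)"
    for h :: "nat \<times> 'g \<Rightarrow> nat \<Rightarrow> 'g \<Rightarrow> 'k" and A i x
    by (induction A rule: infinite_finite_induct) auto
  have "l w = (\<Sum>q\<in>coords G n. l (u q) * case_prod w q)" if w: "w \<in> free_carrier G n" for w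
  proof -
    have "w = (\<Sum>q\<in>coords G n. free_scale (case_prod w q) (u q))"
    proof (intro ext)
      fix i x
      have "(\<Sum>q\<in>coords G n. free_scale (case_prod w q) (u q)) i x
        = (\<Sum>q\<in>coords G n. if q = (i, x) then w i x else 0)"
        unfolding sum_apply by (intro sum.cong) (auto simp: free_scale_def u_def)
      also have "\<dots> = (if (i, x) \<in> coords G n then w i x else 0)"
        using assms(1) by (simp only: sum.delta finite_cartesian_product finite_lessThan if_cancel)
      also have "\<dots> = w i x"
        using w by (cases "i < n") (auto simp: free_carrier_def reg_carrier_def)
      finally show "w i x = (\<Sum>q\<in>coords G n. free_scale (case_prod w q) (u q)) i x" ..
    qed
    then have "l w = l (\<Sum>q\<in>coords G n. free_scale (case_prod w q) (u q))" by simp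
    also have "\<dots> = (\<Sum>q\<in>coords G n. case_prod w q * l (u q))"
      by (rule linear_form_on_sum[OF subspace_free_carrier vector_space_free_scale assms(2)])
         (use assms(1) u in auto)
    finally show ?thesis by (simp add: mult.commute)
  qed
  then show ?thesis
    by (intro exI[of _ "\<lambda>q. l (u q)"] ballI)
qed

lemma hom_polyfuns_expand:
  fixes f :: "(nat \<Rightarrow> 'g \<Rightarrow> 'k::field) \<Rightarrow> 'k"
  assumes fin: "finite (carrier G)"
    and f: "f \<in> hom_polyfuns free_scale (free_carrier G n) d"
  obtains c where "\<And>w. w \<in> free_carrier G n \<Longrightarrow>
    f w = (\<Sum>e\<in>exponents (coords G n) d. c e * (\<Prod>q\<in>coords G n. case_prod w q ^ e q))"
proof -
  from f obtain m :: nat and c l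
    where l: "\<forall>j<m. \<forall>i<d. linear_form_on free_scale (free_carrier G n) (l j i)"
      and fw: "\<forall>w\<in>free_carrier G n. f w = (\<Sum>j<m. c j * (\<Prod>i<d. l j i w))"
    unfolding hom_polyfuns_def by blast
  have "\<exists>b. \<forall>w\<in>free_carrier G n. l j i w = (\<Sum>q\<in>coords G n. b q * case_prod w q)"
    if "j < m" "i < d" for j i
    using linear_form_on_free_carrier_expand[OF fin] l that by blast
  then obtain b where b: "\<And>j i w. j < m \<Longrightarrow> i < d \<Longrightarrow> w \<in> free_carrier G n \<Longrightarrow>
      l j i w = (\<Sum>q\<in>coords G n. b j i q * case_prod w q)"
    by metis
  have "\<forall>j. \<exists>c. \<forall>a. (\<Prod>i<d. \<Sum>q\<in>coords G n. b j i q * a q)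
    = (\<Sum>e\<in>exponents (coords G n) d. c e * (\<Prod>q\<in>coords G n. a q ^ e q))"
    using fin by (intro allI prod_linear_expand) auto
  from choice[OF this] obtain c' where c': "\<forall>j a. (\<Prod>i<d. \<Sum>q\<in>coords G n. b j i q * a q)
    = (\<Sum>e\<in>exponents (coords G n) d. c' j e * (\<Prod>q\<in>coords G n. a q ^ e q))"
    by blast
  show thesis
  proof (rule that)
    fix w :: "nat \<Rightarrow> 'g \<Rightarrow> 'k" assume w: "w \<in> free_carrier G n"
    have "f w = (\<Sum>j<m. c j * (\<Prod>i<d. \<Sum>q\<in>coords G n. b j i q * case_prod w q))"
    proof -
      have "(\<Prod>i<d. l j i w) = (\<Prod>i<d. \<Sum>q\<in>coords G n. b j i q * case_prod w q)" if "j < m" for j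
        using that w by (intro prod.cong refl b) auto
      then show ?thesis using fw w by simp
    qed
    also have "\<dots> = (\<Sum>e\<in>exponents (coords G n) d. (\<Sum>j<m. c j * c' j e) *
        (\<Prod>q\<in>coords G n. case_prod w q ^ e q))"
      unfolding c'[rule_format] sum_distrib_left sum_distrib_right
      by (subst sum.swap) (simp add: mult.assoc)
    finally show "f w = \<dots>" .
  qed
qed

lemma sum_invariant_no_fixed_point:
  fixes h :: "'e \<Rightarrow> 'k::idom"
  assumes act: "group_action G E \<phi>" and fin: "finite E"
    and p: "prime p" "CHAR('k) = p" and ord: "order G = p ^ k"
    and inv: "\<And>g e. g \<in> carrier G \<Longrightarrow> e \<in> E \<Longrightarrow> h (\<phi> g e) = h e"
    and no_fixed: "\<And>e. e \<in> E \<Longrightarrow> \<exists>g\<in>carrier G. \<phi> g e \<noteq> e"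
  shows "sum h E = 0"
proof -
  interpret group_action G E \<phi> by fact
  have "sum h O' = 0" if "O' \<in> orbits G E \<phi>" for O'
  proof -
    from that obtain e where e: "e \<in> E" and O': "O' = orbit G \<phi> e"
      by (auto simp: orbits_def)
    have "card O' dvd p ^ k"
      using orbit_stabilizer_theorem[OF e] ord unfolding O' by (metis dvd_triv_left)
    then obtain j where j: "card O' = p ^ j"
      using p(1) divides_primepow_nat by blast
    have "j \<noteq> 0"
    proof
      assume "j = 0"
      then obtain e' where e': "O' = {e'}" using j by (auto simp: card_1_singleton_iff)
      from orbit_refl[OF e] have "O' = {e}" using e' O' by auto
      then have "\<phi> g e = e" if "g \<in> carrier G" for g
        using that unfolding O' orbit_def by blast
      with no_fixed[OF e] show False by blast
    qed
    then have "of_nat (card O') = (0 :: 'k)"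
      using j p by (simp add: of_nat_eq_0_iff_char_dvd)
    moreover have "sum h O' = (\<Sum>x\<in>O'. h e)"
      using inv e by (intro sum.cong) (auto simp: O' orbit_def)
    ultimately show ?thesis by simp
  qed
  then show ?thesis
    using disjoint_sum[OF fin, of h] by simp
qed

definition shift_exponent :: "('g, 'b) monoid_scheme \<Rightarrow> 'g \<Rightarrow> (nat \<times> 'g \<Rightarrow> nat) \<Rightarrow> nat \<times> 'g \<Rightarrow> nat" where
  "shift_exponent G h e = (\<lambda>(i, y). if y \<in> carrier G then e (i, inv\<^bsub>G\<^esub> h \<otimes>\<^bsub>G\<^esub> y) else 0)"

context group
begin

lemma bij_betw_coords:
  assumes "g \<in> carrier G"
  shows "bij_betw (\<lambda>(i, y). (i, g \<otimes> y)) (coords G n) (coords G n)"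
  by (rule bij_betw_byWitness[where f' = "\<lambda>(i, y). (i, inv g \<otimes> y)"])
     (use assms in \<open>auto simp: m_assoc[symmetric]\<close>)

lemma shift_exponent_mult:
  assumes "g \<in> carrier G" "h \<in> carrier G"
  shows "shift_exponent G (g \<otimes> h) e = shift_exponent G g (shift_exponent G h e)"
  using assms by (auto simp: shift_exponent_def fun_eq_iff inv_mult_group m_assoc)

lemma shift_exponent_one:
  assumes "e \<in> exponents (coords G n) d"
  shows "shift_exponent G \<one> e = e"
  using assms by (auto simp: shift_exponent_def fun_eq_iff exponents_def)

lemma shift_exponent_closed:
  assumes e: "e \<in> exponents (coords G n) d" and g: "g \<in> carrier G"
  shows "shift_exponent G g e \<in> exponents (coords G n) d"
proof -
  have "sum (shift_exponent G g e) (coords G n) = (\<Sum>q\<in>coords G n. e ((\<lambda>(i, y). (i, inv g \<otimes> y)) q))"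
    by (intro sum.cong) (auto simp: shift_exponent_def)
  also have "\<dots> = sum e (coords G n)"
    by (intro sum.reindex_bij_betw bij_betw_coords) (simp add: g)
  finally show ?thesis
    using e g by (auto simp: exponents_def shift_exponent_def)
qed

lemma shift_exponent_inv:
  assumes "e \<in> exponents (coords G n) d" and "g \<in> carrier G"
  shows "shift_exponent G (inv g) (shift_exponent G g e) = e" "shift_exponent G g (shift_exponent G (inv g) e) = e"
  using assms by (simp_all add: shift_exponent_mult[symmetric] shift_exponent_one)

lemma bij_betw_shift_exponent:
  assumes "g \<in> carrier G"
  shows "bij_betw (shift_exponent G g) (exponents (coords G n) d) (exponents (coords G n) d)"
  by (rule bij_betw_byWitness[where f' = "shift_exponent G (inv g)"])
     (use assms shift_exponent_closed in \<open>auto simp: shift_exponent_inv\<close>)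

lemma group_action_shift_exponent:
  assumes P: "subgroup P G"
  shows "group_action (G\<lparr>carrier := P\<rparr>) (exponents (coords G n) d)
    (\<lambda>g. restrict (shift_exponent G g) (exponents (coords G n) d))"
proof -
  let ?M = "exponents (coords G n) d"
  have PG: "g \<in> carrier G" if "g \<in> P" for g
    using subgroup.mem_carrier[OF P that] .
  have Bij: "restrict (shift_exponent G g) ?M \<in> Bij ?M" if "g \<in> P" for g
    using bij_betw_shift_exponent[OF PG[OF that]] by (auto simp: Bij_def)
  have "restrict (shift_exponent G (g \<otimes> h)) ?M = compose ?M (restrict (shift_exponent G g) ?M) (restrict (shift_exponent G h) ?M)"
    if "g \<in> P" "h \<in> P" for g h
    using that PG shift_exponent_closed by (auto simp: fun_eq_iff compose_def shift_exponent_mult)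
  then have "(\<lambda>g. restrict (shift_exponent G g) ?M) \<in> hom (G\<lparr>carrier := P\<rparr>) (BijGroup ?M)"
    using Bij by (auto simp: hom_def BijGroup_def)
  then show ?thesis
    unfolding group_action_def group_hom_def group_hom_axioms_def
    using subgroup_imp_group[OF P] group_BijGroup by blast
qed

lemma monomial_free_act:
  fixes w :: "nat \<Rightarrow> 'a \<Rightarrow> 'k::field"
  assumes h: "h \<in> carrier G"
  shows "(\<Prod>q\<in>coords G n. case_prod (free_act G h w) q ^ e q)
    = (\<Prod>q\<in>coords G n. case_prod w q ^ shift_exponent G (inv h) e q)"
proof -
  let ?F = "\<lambda>q. case_prod (free_act G h w) q ^ e q"
  have "prod ?F (coords G n) = (\<Prod>q\<in>coords G n. ?F ((\<lambda>(i, y). (i, h \<otimes> y)) q))"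
    by (rule prod.reindex_bij_betw[OF bij_betw_coords[OF h], symmetric])
  also have "\<dots> = (\<Prod>q\<in>coords G n. case_prod w q ^ shift_exponent G (inv h) e q)"
    using h by (intro prod.cong)
      (auto simp: free_act_def reg_act_def shift_exponent_def m_assoc[symmetric])
  finally show ?thesis .
qed

lemma coefficients_shift_exponent:
  fixes c :: "(nat \<times> 'a \<Rightarrow> nat) \<Rightarrow> 'k::field"
  assumes inf: "infinite (UNIV :: 'k set)" and fin: "finite (carrier G)" and h: "h \<in> carrier G"
    and f: "\<And>w. w \<in> free_carrier G n \<Longrightarrow>
      f w = (\<Sum>e\<in>exponents (coords G n) d. c e * (\<Prod>q\<in>coords G n. case_prod w q ^ e q))"
    and invar: "\<And>w. w \<in> free_carrier G n \<Longrightarrow> f (free_act G h w) = f w"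
    and e: "e \<in> exponents (coords G n) d"
  shows "c (shift_exponent G h e) = c e"
proof -
  let ?M = "exponents (coords G n) d"
  have "(\<Sum>e\<in>?M. (c (shift_exponent G h e) - c e) * (\<Prod>q\<in>coords G n. a q ^ e q)) = 0" for a :: "nat \<times> 'a \<Rightarrow> 'k"
  proof -
    define w where "w = (\<lambda>i x. if (i, x) \<in> coords G n then a (i, x) else 0)"
    let ?m = "\<lambda>e. \<Prod>q\<in>coords G n. case_prod w q ^ e q"
    have w: "w \<in> free_carrier G n"
      by (auto simp: w_def free_carrier_def reg_carrier_def fun_eq_iff)
    have "f w = f (free_act G h w)"
      using invar w by simp
    also have "\<dots> = (\<Sum>e\<in>?M. c e * ?m (shift_exponent G (inv h) e))"
      unfolding f[OF free_act_closed[OF w]] monomial_free_act[OF h] ..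
    also have "\<dots> = (\<Sum>e\<in>?M. c (shift_exponent G h e) * ?m (shift_exponent G (inv h) (shift_exponent G h e)))"
      by (rule sum.reindex_bij_betw[OF bij_betw_shift_exponent[OF h], symmetric])
    also have "\<dots> = (\<Sum>e\<in>?M. c (shift_exponent G h e) * ?m e)"
      using h by (intro sum.cong) (simp_all add: shift_exponent_inv)
    finally have "(\<Sum>e\<in>?M. (c (shift_exponent G h e) - c e) * ?m e) = 0"
      unfolding f[OF w] by (simp add: left_diff_distrib sum_subtractf)
    moreover have "?m e = (\<Prod>q\<in>coords G n. a q ^ e q)" for e
      by (intro prod.cong) (auto simp: w_def)
    ultimately show ?thesis by simp
  qed
  then have "c (shift_exponent G h e) - c e = 0"
  proof (rule monomials_independent[OF inf, rotated 3])
    show "e1 = e2" if "e1 \<in> ?M" "e2 \<in> ?M" "\<forall>x\<in>coords G n. e1 x = e2 x" for e1 e2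
    proof
      fix q
      show "e1 q = e2 q"
        using that by (cases q, cases "q \<in> coords G n") (auto simp: exponents_def)
    qed
  qed (use fin e in \<open>auto intro!: finite_exponents\<close>)
  then show ?thesis by simp
qed

lemma card_dvd_degree_if_shift_exponent_fixed:
  assumes P: "subgroup P G" and fin: "finite (carrier G)"
    and e: "e \<in> exponents (coords G n) d"
    and fixed: "\<And>g. g \<in> P \<Longrightarrow> shift_exponent G g e = e"
  shows "card P dvd d"
proof -
  have PG: "P \<subseteq> carrier G" by (rule subgroup.subset[OF P])
  have cosets: "card P dvd (\<Sum>x\<in>R. e (i, x))" if "R \<in> rcosets P" for R i
  proof -
    from that obtain y where y: "y \<in> carrier G" and R: "R = P #> y"
      by (auto simp: RCOSETS_def)
    have "e (i, x) = e (i, y)" if "x \<in> R" for x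
    proof -
      from that obtain g where g: "g \<in> P" "x = g \<otimes> y"
        by (auto simp: R r_coset_def)
      then have "shift_exponent G g e (i, x) = e (i, y)"
        using y PG by (auto simp: shift_exponent_def m_assoc[symmetric])
      then show ?thesis using fixed[OF g(1)] by simp
    qed
    then have "(\<Sum>x\<in>R. e (i, x)) = card R * e (i, y)" by simp
    then show ?thesis using card_rcosets_equal[OF that PG] by simp
  qed
  have "card P dvd (\<Sum>x\<in>carrier G. e (i, x))" for i
  proof -
    have "(\<Sum>x\<in>carrier G. e (i, x)) = (\<Sum>R\<in>rcosets P. \<Sum>x\<in>R. e (i, x))"
      unfolding rcosets_part_G[OF P, symmetric]
      using rcosets_finite[OF _ PG finite_subset[OF PG fin]] rcos_disjoint[OF P]
      by (subst sum.Union_disjoint) (auto simp: pairwise_def disjnt_def)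
    then show ?thesis using cosets by (simp add: dvd_sum)
  qed
  then have "card P dvd (\<Sum>i<n. \<Sum>x\<in>carrier G. e (i, x))"
    by (rule dvd_sum)
  then show ?thesis
    using e by (simp add: exponents_def sum.cartesian_product)
qed

lemma hom_invariants_vanish:
  fixes v :: "nat \<Rightarrow> 'a \<Rightarrow> 'k::alg_closed_field"
  assumes p: "prime p" "CHAR('k) = p" and fin: "finite (carrier G)"
    and P: "subgroup P G" "card P = p ^ k" and d: "\<not> card P dvd d"
    and v: "v \<in> fixed_vectors G (free_carrier G n) (free_act G)"
    and f: "f \<in> hom_invariants G free_scale (free_carrier G n) (free_act G) d"
  shows "f v = 0"
proof -
  let ?M = "exponents (coords G n) d" and ?G = "G\<lparr>carrier := P\<rparr>"
  let ?act = "\<lambda>g. restrict (shift_exponent G g) ?M"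
  have PG: "g \<in> carrier G" if "g \<in> P" for g
    using subgroup.mem_carrier[OF P(1) that] .
  have "f \<in> hom_polyfuns free_scale (free_carrier G n) d"
    using f by (simp add: hom_invariants_def)
  from hom_polyfuns_expand[OF fin this] obtain c where c: "\<And>w. w \<in> free_carrier G n \<Longrightarrow>
      f w = (\<Sum>e\<in>?M. c e * (\<Prod>q\<in>coords G n. case_prod w q ^ e q))"
    by blast
  have invar: "f (free_act G h w) = f w" if "h \<in> carrier G" "w \<in> free_carrier G n" for h w
  proof -
    have "fun_act G (free_carrier G n) (free_act G) (inv h) f w = f w"
      using f that(1) unfolding hom_invariants_def by auto
    then show ?thesis using that by (simp add: fun_act_def)
  qed
  have vV: "v \<in> free_carrier G n" and fixed: "\<And>g. g \<in> carrier G \<Longrightarrow> free_act G g v = v"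
    using v by (auto simp: fixed_vectors_def)
  define m where "m e = (\<Prod>q\<in>coords G n. case_prod v q ^ e q)" for e
  have m: "m (shift_exponent G g e) = m e" if "g \<in> carrier G" for g e
    using monomial_free_act[where h = "inv g" and w = v and e = e and n = n] fixed[of "inv g"] that by (simp add: m_def)
  have "(\<Sum>e\<in>?M. c e * m e) = 0"
  proof (rule sum_invariant_no_fixed_point[OF group_action_shift_exponent[OF P(1)] _ p])
    show "finite ?M" using fin by (intro finite_exponents) auto
    show "order ?G = p ^ k" using P(2) by (simp add: order_def)
    show "c (?act g e) * m (?act g e) = c e * m e" if "g \<in> carrier ?G" "e \<in> ?M" for g e
      using that PG coefficients_shift_exponent[OF infinite_UNIV_alg_closed_field fin _ c invar] m
      by simp
    show "\<exists>g\<in>carrier ?G. ?act g e \<noteq> e" if "e \<in> ?M" for e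
      using card_dvd_degree_if_shift_exponent_fixed[OF P(1) fin that] d that by auto
  qed
  then show ?thesis using c[OF vV] by (simp add: m_def)
qed

lemma fixed_vectors_const:
  assumes "v \<in> fixed_vectors G (free_carrier G n) (free_act G)" "x \<in> carrier G"
  shows "v i x = v i \<one>"
proof -
  have "free_act G (inv x) v i \<one> = v i \<one>"
    using assms by (simp add: fixed_vectors_def)
  then show ?thesis using assms(2) by (simp add: free_act_def reg_act_def)
qed

lemma bij_betw_l_coset:
  assumes P: "subgroup P G" and g: "g \<in> carrier G"
  shows "bij_betw (\<lambda>C. g <# C) (lcosets P) (lcosets P)"
proof (rule bij_betw_byWitness[where f' = "\<lambda>C. inv g <# C"])
  have sub: "C \<subseteq> carrier G" if "C \<in> lcosets P" for C
    using lcosets_subset_PowG[OF P] that by blast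
  have "g <# (inv g <# C) = C" "inv g <# (g <# C) = C" if "C \<in> lcosets P" for C
    using sub[OF that] g by (simp_all add: lcos_m_assoc lcos_mult_one)
  then show "\<forall>C\<in>lcosets P. inv g <# (g <# C) = C" "\<forall>C\<in>lcosets P. g <# (inv g <# C) = C"
    by auto
  have "h <# C \<in> lcosets P" if "h \<in> carrier G" "C \<in> lcosets P" for h C
    using that subgroup.subset[OF P] by (auto simp: LCOSETS_def lcos_m_assoc)
  then show "(\<lambda>C. g <# C) ` (lcosets P) \<subseteq> lcosets P"
    "(\<lambda>C. inv g <# C) ` (lcosets P) \<subseteq> lcosets P"
    using g by auto
qed

definition coset_norm :: "nat \<Rightarrow> 'a set \<Rightarrow> nat \<Rightarrow> (nat \<Rightarrow> 'a \<Rightarrow> 'k::field) \<Rightarrow> 'k" where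
  "coset_norm n P i = (\<lambda>w\<in>free_carrier G n. \<Sum>C\<in>lcosets P. \<Prod>x\<in>C. w i x)"

lemma coset_norm_invariant:
  assumes P: "subgroup P G" and fin: "finite (carrier G)"
  shows "(coset_norm n P i :: _ \<Rightarrow> 'k::field) \<in>
    hom_invariants G free_scale (free_carrier G n) (free_act G) (card P)"
proof -
  let ?V = "free_carrier G n :: (nat \<Rightarrow> 'a \<Rightarrow> 'k) set" and ?N = "coset_norm n P i :: _ \<Rightarrow> 'k"
  have PG: "P \<subseteq> carrier G" by (rule subgroup.subset[OF P])
  have sub: "C \<subseteq> carrier G" if "C \<in> lcosets P" for C
    using lcosets_subset_PowG[OF P] that by blast
  have finL: "finite (lcosets P)"
    using finite_subset[OF lcosets_subset_PowG[OF P]] fin by simp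
  have "?N \<in> hom_polyfuns free_scale ?V (card P)"
  proof -
    obtain r where r: "bij_betw r {..<card (lcosets P)} (lcosets P)"
      using finL by (metis ex_bij_betw_nat_finite atLeast0LessThan)
    have rC: "r j \<in> lcosets P" if "j < card (lcosets P)" for j
      using r that by (auto simp: bij_betw_def)
    have "\<exists>s. bij_betw s {..<card P} (r j)" if "j < card (lcosets P)" for j
      using l_card_cosets_equal[OF rC[OF that] PG fin] finite_subset[OF sub[OF rC[OF that]] fin]
      by (metis ex_bij_betw_nat_finite atLeast0LessThan)
    then obtain s where s: "\<And>j. j < card (lcosets P) \<Longrightarrow> bij_betw (s j) {..<card P} (r j)"
      by metis
    have "?N w = (\<Sum>j<card (lcosets P). 1 * (\<Prod>t<card P. w i (s j t)))" if "w \<in> ?V" for w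
    proof -
      have "?N w = (\<Sum>j<card (lcosets P). \<Prod>x\<in>r j. w i x)"
        using that by (simp add: coset_norm_def sum.reindex_bij_betw[OF r, symmetric])
      also have "\<dots> = (\<Sum>j<card (lcosets P). 1 * (\<Prod>t<card P. w i (s j t)))"
        by (intro sum.cong) (simp_all add: prod.reindex_bij_betw[OF s, symmetric])
      finally show ?thesis .
    qed
    moreover have "linear_form_on free_scale ?V (\<lambda>w. w i x)" for x
      by (simp add: linear_form_on_def free_scale_def)
    ultimately show ?thesis
      unfolding hom_polyfuns_def coset_norm_def
      by (intro CollectI conjI exI[of _ "card (lcosets P)"] exI[of _ "\<lambda>_. 1"]
          exI[of _ "\<lambda>j t w. w i (s j t)"]) (auto simp: coset_norm_def)
  qed
  moreover have "fun_act G ?V (free_act G) g ?N = ?N" if g: "g \<in> carrier G" for g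
  proof
    fix w
    show "fun_act G ?V (free_act G) g ?N w = ?N w"
    proof (cases "w \<in> ?V")
      case True
      have "fun_act G ?V (free_act G) g ?N w = ?N (free_act G (inv g) w)"
        using True by (simp add: fun_act_def)
      also have "\<dots> = (\<Sum>C\<in>lcosets P. \<Prod>x\<in>C. free_act G (inv g) w i x)"
        using free_act_closed[OF True] by (simp add: coset_norm_def)
      also have "\<dots> = (\<Sum>C\<in>lcosets P. \<Prod>x\<in>g <# C. w i x)"
      proof (intro sum.cong refl)
        fix C assume "C \<in> lcosets P"
        then have C: "C \<subseteq> carrier G" by (rule sub)
        have "g <# C = (\<lambda>x. g \<otimes> x) ` C" by (auto simp: l_coset_def)
        moreover have "inj_on (\<lambda>x. g \<otimes> x) C" using inj_on_g'[OF C g] .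
        ultimately have "(\<Prod>x\<in>g <# C. w i x) = (\<Prod>x\<in>C. w i (g \<otimes> x))"
          by (simp add: prod.reindex)
        also have "\<dots> = (\<Prod>x\<in>C. free_act G (inv g) w i x)"
          using C g by (intro prod.cong) (auto simp: free_act_def reg_act_def)
        finally show "(\<Prod>x\<in>C. free_act G (inv g) w i x) = (\<Prod>x\<in>g <# C. w i x)" ..
      qed
      also have "\<dots> = (\<Sum>C\<in>lcosets P. \<Prod>x\<in>C. w i x)"
        by (rule sum.reindex_bij_betw[OF bij_betw_l_coset[OF P g]])
      also have "\<dots> = ?N w" using True by (simp add: coset_norm_def)
      finally show ?thesis .
    qed (simp add: fun_act_def coset_norm_def)
  qed
  ultimately show ?thesis by (simp add: hom_invariants_def)
qed

lemma coset_norm_fixed_vector: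
  assumes P: "subgroup P G" and fin: "finite (carrier G)"
    and v: "v \<in> fixed_vectors G (free_carrier G n) (free_act G)"
  shows "coset_norm n P i v = of_nat (card (lcosets P)) * v i \<one> ^ card P"
proof -
  have "(\<Prod>x\<in>C. v i x) = v i \<one> ^ card P" if "C \<in> lcosets P" for C
  proof -
    have "(\<Prod>x\<in>C. v i x) = (\<Prod>x\<in>C. v i \<one>)"
      using lcosets_subset_PowG[OF P] that by (intro prod.cong fixed_vectors_const[OF v]) auto
    then show ?thesis
      using l_card_cosets_equal[OF that subgroup.subset[OF P] fin] by simp
  qed
  then show ?thesis using v by (simp add: coset_norm_def fixed_vectors_def)
qed

end

lemma sylow_index_not_dvd:
  assumes "group G" "finite (carrier G)" "prime p" "sylow_subgroup p G P"
  shows "\<not> p dvd card (lcosets\<^bsub>G\<^esub> P)"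
proof
  interpret group G by fact
  let ?k = "multiplicity p (order G)"
  assume "p dvd card (lcosets\<^bsub>G\<^esub> P)"
  moreover have "card (lcosets\<^bsub>G\<^esub> P) * p ^ ?k = order G"
    using assms l_lagrange unfolding sylow_subgroup_def by metis
  ultimately have "p ^ Suc ?k dvd order G"
    by (metis mult_dvd_mono dvd_refl power_Suc)
  moreover have "order G \<noteq> 0"
    using assms(2) order_gt_0_iff_finite by simp
  ultimately show False
    using multiplicity_geI[of "order G" p "Suc ?k"] not_prime_unit assms(3) by fastforce
qed

theorem lemma3p2:
  fixes G :: "('g, 'b) monoid_scheme"
    and P :: "'g set"
    and n p :: nat
    and v :: "nat \<Rightarrow> 'g \<Rightarrow> 'k::alg_closed_field"
  assumes "CHAR('k) = p" and "p > 0"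
    and "group G" and "finite (carrier G)"
    and "sylow_subgroup p G P"
    and "v \<in> fixed_vectors G (free_carrier G n) (free_act G) - {0}"
  shows "epsilon G free_scale (free_carrier G n) (free_act G) v = enat (card P)"
proof -
  interpret group G by fact
  have p: "prime p" using assms(1,2) prime_CHAR_semidom by blast
  have P: "subgroup P G" "card P = p ^ multiplicity p (order G)"
    using assms(5) by (auto simp: sylow_subgroup_def)
  have v: "v \<in> fixed_vectors G (free_carrier G n) (free_act G)" and "v \<noteq> 0"
    using assms(6) by auto
  then obtain i x where ix: "v i x \<noteq> 0" by (auto simp: fun_eq_iff)
  have "v \<in> free_carrier G n" using v by (simp add: fixed_vectors_def)
  then have "x \<in> carrier G"
    using ix by (cases "i < n") (auto simp: free_carrier_def reg_carrier_def)
  then have "v i \<one>\<^bsub>G\<^esub> \<noteq> 0" using ix fixed_vectors_const[OF v, of x i] by simp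
  then have "coset_norm n P i v \<noteq> 0"
    using sylow_index_not_dvd[OF assms(3,4) p assms(5)] assms(1)
    by (simp add: coset_norm_fixed_vector[OF P(1) assms(4) v] of_nat_eq_0_iff_char_dvd)
  moreover have "card P > 0" using P(2) p by (simp add: prime_gt_0_nat)
  ultimately have upper: "epsilon G free_scale (free_carrier G n) (free_act G) v \<le> enat (card P)"
    unfolding epsilon_def using coset_norm_invariant[OF P(1) assms(4)]
    by (intro Inf_lower) blast
  have "enat (card P) \<le> epsilon G free_scale (free_carrier G n) (free_act G) v"
    unfolding epsilon_def
  proof (rule Inf_greatest, clarify)
    fix d f assume "d > 0" "f v \<noteq> 0"
      and "f \<in> hom_invariants G free_scale (free_carrier G n) (free_act G) d"
    then have "card P dvd d"
      using hom_invariants_vanish[OF p assms(1,4) P _ v] by blast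
    with \<open>d > 0\<close> show "enat (card P) \<le> enat d" by (simp add: dvd_imp_le)
  qed
  with upper show ?thesis by (rule antisym)
qed

end
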